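(* Let $T>0$ and let $A$ be a positive definite, selfadjoint, linear operator on a Hilbert space $H$ with domain $D(A)$ dense in $H$. The six-step BDF method for $u'(t)+Au(t)=0$ is stable in the following sense: there exists a constant $C$, independent of the time step $\tau$ and of $n$, such that for every integer $N\geq 6$, with $\tau:=T/N$, and all starting approximations $u^0,\dots,u^5\in V$, the sequence $u^6,\dots,u^N$ defined recursively by $$\sum_{i=0}^6\alpha_i u^{n+i}+\tau A u^{n+6}=0,\qquad n=0,\dots,N-6,$$ satisfies $$|u^n|^2+\tau\sum_{\ell=6}^n\|u^\ell\|^2\leq C\sum_{j=0}^5\bigl(|u^j|^2+\tau\|u^j\|^2\bigr),\qquad n=6,\dots,N.$$
   Context: The coefficients $\alpha_0,\dots,\alpha_6$ of the six-step BDF (backward difference formula) method are defined by $$\sum_{j=0}^6\alpha_j\zeta^j=\alpha(\zeta)=\sum_{j=1}^6\frac1j\,\zeta^{6-j}(\zeta-1)^j .$$ $(\cdot,\cdot)$ is the inner product of $H$ and $|\cdot|$ the norm on $H$ induced by it; $V:=D(A^{1/2})$, with norm $\|v\|:=|A^{1/2}v|$. *)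

theory Defs
  imports "HOL-Analysis.Analysis" "HOL-Computational_Algebra.Polynomial"
begin

(* A (possibly unbounded) operator on H is a pair of its domain D and a total function A whose
   values off D are irrelevant.  H is a real Hilbert space; a complex one is covered through its
   underlying real space with inner product Re (x, y), for which the norm, the graph of the adjoint,
   positivity and square roots are unchanged. *)

definition linear_op :: "'a::real_vector set \<Rightarrow> ('a \<Rightarrow> 'a) \<Rightarrow> bool" where
  "linear_op D A \<longleftrightarrow> subspace D \<and>
     (\<forall>x\<in>D. \<forall>y\<in>D. A (x + y) = A x + A y) \<and> (\<forall>c. \<forall>x\<in>D. A (c *\<^sub>R x) = c *\<^sub>R A x)"

definition op_graph :: "'a set \<Rightarrow> ('a \<Rightarrow> 'a) \<Rightarrow> ('a \<times> 'a) set" where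
  "op_graph D A = {(x, A x) |x. x \<in> D}"

definition adjoint_graph :: "'a::real_inner set \<Rightarrow> ('a \<Rightarrow> 'a) \<Rightarrow> ('a \<times> 'a) set" where
  "adjoint_graph D A = {(y, z). \<forall>x\<in>D. A x \<bullet> y = x \<bullet> z}"

definition selfadjoint_op :: "'a::real_inner set \<Rightarrow> ('a \<Rightarrow> 'a) \<Rightarrow> bool" where
  "selfadjoint_op D A \<longleftrightarrow>
     linear_op D A \<and> closure D = UNIV \<and> adjoint_graph D A = op_graph D A"

definition positive_definite_op :: "'a::real_inner set \<Rightarrow> ('a \<Rightarrow> 'a) \<Rightarrow> bool" where
  "positive_definite_op D A \<longleftrightarrow> (\<forall>x\<in>D. x \<noteq> 0 \<longrightarrow> 0 < A x \<bullet> x)"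

definition nonneg_op :: "'a::real_inner set \<Rightarrow> ('a \<Rightarrow> 'a) \<Rightarrow> bool" where
  "nonneg_op D A \<longleftrightarrow> (\<forall>x\<in>D. 0 \<le> A x \<bullet> x)"

(* (E, B) is a nonnegative selfadjoint operator with B B = A, equality of domains included. *)
definition is_sqrt_op ::
  "'a::real_inner set \<Rightarrow> ('a \<Rightarrow> 'a) \<Rightarrow> 'a set \<Rightarrow> ('a \<Rightarrow> 'a) \<Rightarrow> bool" where
  "is_sqrt_op D A E B \<longleftrightarrow> selfadjoint_op E B \<and> nonneg_op E B \<and>
     {x \<in> E. B x \<in> E} = D \<and> (\<forall>x\<in>D. B (B x) = A x)"

(* For nonnegative selfadjoint A on a Hilbert space such (E, B) exists, and E and the restriction of
   B to E are unique; the choice only fixes the irrelevant values of B off E. *)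
definition sqrt_op :: "'a::real_inner set \<Rightarrow> ('a \<Rightarrow> 'a) \<Rightarrow> 'a set \<times> ('a \<Rightarrow> 'a)" where
  "sqrt_op D A = (SOME (E, B). is_sqrt_op D A E B)"

definition V_space :: "'a::real_inner set \<Rightarrow> ('a \<Rightarrow> 'a) \<Rightarrow> 'a set" where
  "V_space D A = fst (sqrt_op D A)"

definition V_norm :: "'a::real_inner set \<Rightarrow> ('a \<Rightarrow> 'a) \<Rightarrow> 'a \<Rightarrow> real" where
  "V_norm D A v = norm (snd (sqrt_op D A) v)"

definition bdf6_poly :: "real poly" where
  "bdf6_poly = (\<Sum>j=1..6. smult (1 / real j) (monom 1 (6 - j) * [:-1, 1:] ^ j))"

definition bdf6_coeff :: "nat \<Rightarrow> real" where
  "bdf6_coeff i = coeff bdf6_poly i"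

(* Only u 0, ..., u N are constrained. *)
definition bdf6_scheme ::
  "'a::real_inner set \<Rightarrow> ('a \<Rightarrow> 'a) \<Rightarrow> real \<Rightarrow> nat \<Rightarrow> (nat \<Rightarrow> 'a) \<Rightarrow> bool" where
  "bdf6_scheme D A \<tau> N u \<longleftrightarrow>
     (\<forall>n. n + 6 \<le> N \<longrightarrow> u (n + 6) \<in> D \<and>
        (\<Sum>i=0..6. bdf6_coeff i *\<^sub>R u (n + i)) + \<tau> *\<^sub>R A (u (n + 6)) = 0)"

end

theory Submission
  imports Defs
begin

text \<open>
  The six-step BDF method is not A-stable, so testing the scheme with
  u (n + 6) itself does not give an estimate. Instead it is tested with the combination
  u (n + 6) - 13/9 u (n + 5) + 25/36 u (n + 4) - 1/9 u (n + 3), which is the multiplier of Akrivis,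
  Chen, Yu and Zhou. Two facts make this work. First, the product of the difference operator and the
  multiplier is a difference of values of a positive definite quadratic form, the energy, at
  consecutive time levels plus a sum of squares (bdf_energy_step). Secondly, the product of
  A u (n + 6) and the multiplier has the same structure for the symmetric form (A v, w), with the
  additional term |A^(1/2) u (n + 6)|^2 (multiplier_energy_step). Both are instances of
  Dahlquist's G-stability: a trigonometric polynomial that is nonnegative gives such an identity by
  spectral factorization. Here the identities are explicit, with integer coefficients. Summation
  over the time levels telescopes, and the upper and lower bounds of the two forms give the stability
  estimate (bdf6_stability).

  The V-norm is defined through a square root of the unbounded operator A that is selected by the
  choice operator, so the argument also needs that some selfadjoint nonnegative square root exists
  (sqrt_op_exists). This is shown without the spectral theorem: the resolvent R, the inverse of
  I + A, is a bounded operator with 0 \<le> R \<le> I; bounded square roots P of R and W of I - R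
  are limits of a simple iteration, and W P^(-1) is the square root of A.
\<close>

section \<open>Projection onto closed subspaces\<close>

lemma parallelogram_midpoint:
  fixes x p q :: "'a::real_inner"
  shows "(norm (p - q))\<^sup>2 = 2 * (norm (x - p))\<^sup>2 + 2 * (norm (x - q))\<^sup>2
      - 4 * (norm (x - (1/2) *\<^sub>R (p + q)))\<^sup>2"
  unfolding power2_norm_eq_inner
  by (simp add: inner_simps inner_commute algebra_simps)

text \<open>
  By the parallelogram law, two points of M whose distances to x are almost minimal are close to
  each other, because their midpoint also lies in M. A minimizing sequence is therefore Cauchy.
\<close>

lemma closed_subspace_nearest_point:
  fixes x :: "'a::{real_inner, complete_space}"
  assumes "subspace M" "closed M"
  shows "\<exists>p\<in>M. \<forall>m\<in>M. norm (x - p) \<le> norm (x - m)"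
proof -
  define d where "d = Inf ((\<lambda>m. (norm (x - m))\<^sup>2) ` M)"
  have ne: "M \<noteq> {}"
    using assms(1) subspace_0 by blast
  have bdd: "bdd_below ((\<lambda>m. (norm (x - m))\<^sup>2) ` M)"
    by (rule bdd_belowI[of _ 0]) auto
  have d_le: "d \<le> (norm (x - m))\<^sup>2" if "m \<in> M" for m
    unfolding d_def using that by (intro cInf_lower bdd) auto
  have "\<exists>m\<in>M. (norm (x - m))\<^sup>2 < d + 1 / real (Suc n)" for n
  proof -
    have "Inf ((\<lambda>m. (norm (x - m))\<^sup>2) ` M) < d + 1 / real (Suc n)"
      by (simp add: d_def)
    then show ?thesis
      using cInf_lessD[of "(\<lambda>m. (norm (x - m))\<^sup>2) ` M"] ne by blast
  qed
  then obtain s where sM: "\<And>n. s n \<in> M"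
    and s_less: "\<And>n. (norm (x - s n))\<^sup>2 < d + 1 / real (Suc n)"
    by metis
  have close: "(norm (s m - s n))\<^sup>2 < 2 / real (Suc m) + 2 / real (Suc n)" for m n
  proof -
    have "(1/2) *\<^sub>R (s m + s n) \<in> M"
      using assms(1) sM by (intro subspace_mul subspace_add)
    then show ?thesis
      using parallelogram_midpoint[of "s m" "s n" x] d_le s_less[of m] s_less[of n]
      by (smt (verit, best) add_divide_distrib)
  qed
  have "Cauchy s"
  proof (rule CauchyI)
    fix e :: real
    assume e: "0 < e"
    obtain k where k: "4 / e\<^sup>2 < real k"
      using reals_Archimedean2 by blast
    have "norm (s m - s n) < e" if "k \<le> m" "k \<le> n" for m n
    proof -
      have *: "2 / real (Suc j) < e\<^sup>2 / 2" if "k \<le> j" for j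
      proof -
        have "4 / e\<^sup>2 < real (Suc j)"
          using k that by linarith
        then show ?thesis
          using e by (simp add: field_simps)
      qed
      have "(norm (s m - s n))\<^sup>2 < e\<^sup>2"
        using close[of m n] *[OF that(1)] *[OF that(2)] by linarith
      then show ?thesis
        using e by (simp add: power2_less_imp_less)
    qed
    then show "\<exists>M. \<forall>m\<ge>M. \<forall>n\<ge>M. norm (s m - s n) < e"
      by blast
  qed
  then obtain p where p: "s \<longlonglongrightarrow> p"
    using Cauchy_convergent convergent_def by blast
  have "p \<in> M"
    using assms(2) sM p closed_sequentially by blast
  moreover have "(norm (x - p))\<^sup>2 \<le> d"
  proof (rule LIMSEQ_le)
    show "(\<lambda>n. (norm (x - s n))\<^sup>2) \<longlonglongrightarrow> (norm (x - p))\<^sup>2"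
      by (intro tendsto_intros p)
    show "(\<lambda>n. d + 1 / real (Suc n)) \<longlonglongrightarrow> d"
      using tendsto_add[OF tendsto_const LIMSEQ_inverse_real_of_nat, of d]
      by (simp add: inverse_eq_divide)
    show "\<exists>N. \<forall>n\<ge>N. (norm (x - s n))\<^sup>2 \<le> d + 1 / real (Suc n)"
      using s_less less_imp_le by blast
  qed
  ultimately show ?thesis
    using d_le by (meson norm_ge_zero order_trans power2_le_imp_le)
qed

text \<open>
  If p is the point of M nearest to x, then x - p is orthogonal to M: moving p along m by the
  optimal amount decreases the squared distance by (m \<bullet> (x - p))^2 / (m \<bullet> m).
\<close>

lemma closed_subspace_eq_UNIV:
  fixes M :: "'a::{real_inner, complete_space} set"
  assumes "subspace M" "closed M"
    and orth: "\<And>z. (\<And>m. m \<in> M \<Longrightarrow> m \<bullet> z = 0) \<Longrightarrow> z = 0"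
  shows "M = UNIV"
proof -
  have "x \<in> M" for x
  proof -
    obtain p where p: "p \<in> M" and min: "\<And>m. m \<in> M \<Longrightarrow> norm (x - p) \<le> norm (x - m)"
      using closed_subspace_nearest_point[OF assms(1,2)] by blast
    have "m \<bullet> (x - p) = 0" if m: "m \<in> M" for m
    proof (rule ccontr)
      assume a: "m \<bullet> (x - p) \<noteq> 0"
      then have m0: "0 < m \<bullet> m"
        by auto
      define t where "t = (m \<bullet> (x - p)) / (m \<bullet> m)"
      have "p + t *\<^sub>R m \<in> M"
        using assms(1) p m by (intro subspace_add subspace_mul)
      then have "(norm (x - p))\<^sup>2 \<le> (norm (x - p - t *\<^sub>R m))\<^sup>2"
        using min[of "p + t *\<^sub>R m"] by (simp add: diff_diff_add)
      also have "\<dots> = (norm (x - p))\<^sup>2 - 2 * t * (m \<bullet> (x - p)) + t\<^sup>2 * (m \<bullet> m)"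
        unfolding power2_norm_eq_inner
        by (simp add: inner_simps inner_commute power2_eq_square algebra_simps)
      also have "\<dots> = (norm (x - p))\<^sup>2 - (m \<bullet> (x - p))\<^sup>2 / (m \<bullet> m)"
        using m0 by (simp add: t_def field_simps power2_eq_square)
      finally have "(m \<bullet> (x - p))\<^sup>2 / (m \<bullet> m) \<le> 0"
        by simp
      then show False
        using a m0 by (simp add: divide_le_0_iff)
    qed
    then have "x - p = 0"
      by (rule orth)
    then show ?thesis
      using p by simp
  qed
  then show ?thesis
    by auto
qed

section \<open>Square roots of bounded operators\<close>

text \<open>
  The substitution X = I - Y turns the equation X^2 = Q into the fixed point equation
  Y = (I - Q + Y^2) / 2, which is solved by iteration from Y = 0. All iterates are polynomials
  in I - Q with nonnegative coefficients, and I - Q is a contraction; hence the norms of the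
  iterates and of their increments are bounded by the corresponding numbers of the scalar
  iteration y = (1 + y^2) / 2, the majorant below, which increases and stays below 1. So the
  iterates converge pointwise, even uniformly on bounded sets.
\<close>

locale contraction_sqrt =
  fixes Q :: "'a::{real_inner, complete_space} \<Rightarrow> 'a"
  assumes lin: "linear Q"
    and sym: "\<And>x y. Q x \<bullet> y = x \<bullet> Q y"
    and near_id: "\<And>x. norm (x - Q x) \<le> norm x"
begin

primrec iterate :: "nat \<Rightarrow> 'a \<Rightarrow> 'a" where
  "iterate 0 x = 0"
| "iterate (Suc n) x = (1/2) *\<^sub>R (x - Q x + iterate n (iterate n x))"

primrec majorant :: "nat \<Rightarrow> real" where
  "majorant 0 = 0"
| "majorant (Suc n) = (1 + (majorant n)\<^sup>2) / 2"

lemma majorant_bounds: "0 \<le> majorant n \<and> majorant n \<le> 1"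
proof (induction n)
  case (Suc n)
  then have "(majorant n)\<^sup>2 \<le> 1"
    by (simp add: abs_square_le_1)
  then show ?case
    by simp
qed simp

lemma majorant_mono: "majorant n \<le> majorant (Suc n)"
proof -
  have "0 \<le> (1 - majorant n)\<^sup>2"
    by simp
  then show ?thesis
    by (simp add: power2_eq_square algebra_simps)
qed

lemma linear_iterate: "linear (iterate n)"
proof (induction n)
  case 0
  then show ?case
    by (simp add: linear_iff)
next
  case (Suc n)
  then show ?case
    using lin by (simp add: linear_iff algebra_simps)
qed

lemma iterate_symmetric: "iterate n u \<bullet> v = u \<bullet> iterate n v"
proof (induction n arbitrary: u v)
  case (Suc n)
  show ?case
    by (simp add: inner_simps sym Suc.IH)
qed simp

lemma norm_iterate: "norm (iterate n x) \<le> majorant n * norm x"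
proof (induction n arbitrary: x)
  case (Suc n)
  have "norm (iterate n (iterate n x)) \<le> majorant n * norm (iterate n x)"
    by (rule Suc.IH)
  also have "\<dots> \<le> majorant n * (majorant n * norm x)"
    using Suc.IH majorant_bounds by (intro mult_left_mono) auto
  finally have "norm (x - Q x + iterate n (iterate n x)) \<le> norm x + (majorant n)\<^sup>2 * norm x"
    using near_id[of x] by (intro norm_triangle_le) (simp add: power2_eq_square algebra_simps)
  moreover have "norm (iterate (Suc n) x) = norm (x - Q x + iterate n (iterate n x)) / 2"
    by (simp only: iterate.simps norm_scaleR)
  ultimately show ?case
    by (simp add: algebra_simps)
qed simp

lemma iterate_commutes:
  assumes C: "linear C" and CQ: "\<And>x. C (Q x) = Q (C x)"
  shows "C (iterate n x) = iterate n (C x)"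
proof (induction n arbitrary: x)
  case 0
  then show ?case
    by (simp add: linear_0[OF C])
next
  case (Suc n)
  then show ?case
    by (simp add: linear_cmul[OF C] linear_add[OF C] linear_diff[OF C] CQ)
qed

lemma iterates_commute: "iterate m (iterate n x) = iterate n (iterate m x)"
  by (intro iterate_commutes linear_iterate iterate_commutes[symmetric] lin) simp

text \<open>
  Since the iterates commute, a difference of squares factors, and the estimate is inherited
  from (y' + y)(y' - y) / 2 = (y'^2 - y^2) / 2, where y and y' are consecutive scalar iterates.
\<close>

lemma norm_iterate_step: "norm (iterate (Suc n) x - iterate n x) \<le> (majorant (Suc n) - majorant n) * norm x"
proof (induction n arbitrary: x)
  case 0
  show ?case
    using near_id[of x] by simp
next
  case (Suc n)
  let ?d = "iterate (Suc n) x - iterate n x"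
  have "iterate (Suc (Suc n)) x - iterate (Suc n) x
      = (1/2) *\<^sub>R (iterate (Suc n) (iterate (Suc n) x) - iterate n (iterate n x))"
    by (subst (1 2) iterate.simps(2)) (simp only: algebra_simps)
  also have "\<dots> = (1/2) *\<^sub>R (iterate (Suc n) ?d + iterate n ?d)"
    using iterates_commute[of "Suc n" n x]
    by (simp only: linear_diff[OF linear_iterate]) (simp only: algebra_simps)
  finally have "norm (iterate (Suc (Suc n)) x - iterate (Suc n) x) = norm (iterate (Suc n) ?d + iterate n ?d) / 2"
    by (simp only: norm_scaleR)
  also have "\<dots> \<le> (majorant (Suc n) * norm ?d + majorant n * norm ?d) / 2"
    using norm_iterate[of "Suc n" ?d] norm_iterate[of n ?d]
    by (intro divide_right_mono norm_triangle_le) linarith+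
  also have "\<dots> = (majorant (Suc n) + majorant n) / 2 * norm ?d"
    by (simp only: algebra_simps add_divide_distrib)
  also have "\<dots> \<le> (majorant (Suc n) + majorant n) / 2 * ((majorant (Suc n) - majorant n) * norm x)"
    using Suc.IH[of x] majorant_bounds[of n] majorant_bounds[of "Suc n"] by (intro mult_left_mono) auto
  also have "\<dots> = (majorant (Suc (Suc n)) - majorant (Suc n)) * norm x"
    by (simp add: power2_eq_square field_simps)
  finally show ?case .
qed

lemma norm_iterate_diff:
  assumes "n \<le> m"
  shows "norm (iterate m x - iterate n x) \<le> (majorant m - majorant n) * norm x"
  using assms
proof (induction m rule: dec_induct)
  case (step m)
  have "norm (iterate (Suc m) x - iterate n x) \<le> norm (iterate (Suc m) x - iterate m x) + norm (iterate m x - iterate n x)"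
    using norm_triangle_ineq[of "iterate (Suc m) x - iterate m x" "iterate m x - iterate n x"] by (simp only: algebra_simps) simp
  also have "\<dots> \<le> (majorant (Suc m) - majorant m) * norm x + (majorant m - majorant n) * norm x"
    using norm_iterate_step step.IH by (intro add_mono)
  finally show ?case
    by (simp only: algebra_simps)
qed simp

lemma iterate_convergent: "convergent (\<lambda>n. iterate n x)"
proof -
  have inc: "incseq majorant"
    using majorant_mono by (rule incseq_SucI)
  obtain l where "majorant \<longlonglongrightarrow> l"
    using incseq_convergent[OF inc] majorant_bounds by blast
  then have "Cauchy (\<lambda>n. majorant n * norm x)"
    by (rule LIMSEQ_imp_Cauchy[OF tendsto_mult_right])
  then have *: "\<exists>M. \<forall>m\<ge>M. \<forall>n\<ge>M. norm (majorant m * norm x - majorant n * norm x) < e" if "0 < e" for e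
    using that CauchyD by blast
  have le: "norm (iterate m x - iterate n x) \<le> norm (majorant m * norm x - majorant n * norm x)" for m n
  proof (cases "n \<le> m")
    case True
    then have "norm (iterate m x - iterate n x) \<le> majorant m * norm x - majorant n * norm x"
      using norm_iterate_diff[of n m x] by (simp only: left_diff_distrib)
    then show ?thesis
      by simp
  next
    case False
    then have "norm (iterate n x - iterate m x) \<le> majorant n * norm x - majorant m * norm x"
      using norm_iterate_diff[of m n x] by (simp only: left_diff_distrib)
    then show ?thesis
      by (simp add: norm_minus_commute)
  qed
  have "Cauchy (\<lambda>n. iterate n x)"
  proof (rule CauchyI)
    fix e :: real
    assume "0 < e"
    then show "\<exists>M. \<forall>m\<ge>M. \<forall>n\<ge>M. norm (iterate m x - iterate n x) < e"
      using *[of e] le by (meson le_less_trans)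
  qed
  then show ?thesis
    by (rule Cauchy_convergent)
qed

definition iterate_lim :: "'a \<Rightarrow> 'a" where
  "iterate_lim x = lim (\<lambda>n. iterate n x)"

lemma iterate_tendsto: "(\<lambda>n. iterate n x) \<longlonglongrightarrow> iterate_lim x"
  unfolding iterate_lim_def using iterate_convergent convergent_LIMSEQ_iff by blast

lemma linear_iterate_lim: "linear iterate_lim"
proof (rule linearI)
  fix u v :: 'a and c :: real
  have "(\<lambda>n. iterate n (u + v)) \<longlonglongrightarrow> iterate_lim u + iterate_lim v"
    unfolding linear_add[OF linear_iterate] by (intro tendsto_add iterate_tendsto)
  then show "iterate_lim (u + v) = iterate_lim u + iterate_lim v"
    using iterate_tendsto LIMSEQ_unique by blast
  have "(\<lambda>n. iterate n (c *\<^sub>R u)) \<longlonglongrightarrow> c *\<^sub>R iterate_lim u"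
    unfolding linear_cmul[OF linear_iterate] by (intro tendsto_scaleR tendsto_const iterate_tendsto)
  then show "iterate_lim (c *\<^sub>R u) = c *\<^sub>R iterate_lim u"
    using iterate_tendsto LIMSEQ_unique by blast
qed

lemma iterate_lim_symmetric: "iterate_lim u \<bullet> v = u \<bullet> iterate_lim v"
proof -
  have "(\<lambda>n. iterate n u \<bullet> v) \<longlonglongrightarrow> iterate_lim u \<bullet> v"
    by (intro tendsto_inner iterate_tendsto tendsto_const)
  moreover have "(\<lambda>n. iterate n u \<bullet> v) \<longlonglongrightarrow> u \<bullet> iterate_lim v"
    unfolding iterate_symmetric by (intro tendsto_inner iterate_tendsto tendsto_const)
  ultimately show ?thesis
    using LIMSEQ_unique by blast
qed

lemma iterate_contraction: "norm (iterate n x) \<le> norm x"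
  using norm_iterate[of n x] majorant_bounds[of n] mult_right_mono[of "majorant n" 1 "norm x"] by simp

lemma norm_iterate_lim: "norm (iterate_lim x) \<le> norm x"
  using iterate_contraction by (intro LIMSEQ_le_const2[OF tendsto_norm[OF iterate_tendsto]]) blast

text \<open>
  Pointwise convergence carries over to the squares because all iterates are contractions.
\<close>

lemma iterate_twice_tendsto: "(\<lambda>n. iterate n (iterate n x)) \<longlonglongrightarrow> iterate_lim (iterate_lim x)"
proof -
  have "(\<lambda>n. iterate n (iterate n x - iterate_lim x)) \<longlonglongrightarrow> 0"
  proof (rule Lim_null_comparison)
    show "\<forall>\<^sub>F n in sequentially. norm (iterate n (iterate n x - iterate_lim x)) \<le> norm (iterate n x - iterate_lim x)"
      using iterate_contraction by simp
    show "(\<lambda>n. norm (iterate n x - iterate_lim x)) \<longlonglongrightarrow> 0"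
      using tendsto_norm[OF tendsto_diff[OF iterate_tendsto[of x] tendsto_const[of "iterate_lim x"]]] by simp
  qed
  from tendsto_add[OF this iterate_tendsto[of "iterate_lim x"]] show ?thesis
    by (simp add: linear_diff[OF linear_iterate])
qed

lemma iterate_lim_fixpoint: "iterate_lim x = (1/2) *\<^sub>R (x - Q x + iterate_lim (iterate_lim x))"
proof -
  have "(\<lambda>n. iterate (Suc n) x) \<longlonglongrightarrow> (1/2) *\<^sub>R (x - Q x + iterate_lim (iterate_lim x))"
    unfolding iterate.simps(2) by (intro tendsto_intros iterate_twice_tendsto)
  moreover have "(\<lambda>n. iterate (Suc n) x) \<longlonglongrightarrow> iterate_lim x"
    using iterate_tendsto by (rule LIMSEQ_Suc)
  ultimately show ?thesis
    using LIMSEQ_unique by blast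
qed

lemma iterate_lim_commutes:
  assumes C: "bounded_linear C" and CQ: "\<And>x. C (Q x) = Q (C x)"
  shows "C (iterate_lim x) = iterate_lim (C x)"
proof -
  have "(\<lambda>n. C (iterate n x)) \<longlonglongrightarrow> C (iterate_lim x)"
    by (rule bounded_linear.tendsto[OF C iterate_tendsto])
  then have "(\<lambda>n. iterate n (C x)) \<longlonglongrightarrow> C (iterate_lim x)"
    by (simp add: iterate_commutes[OF bounded_linear.linear[OF C] CQ])
  then show ?thesis
    using iterate_tendsto LIMSEQ_unique by blast
qed

end

text \<open>
  The bound on I - X gives both that X is bounded and that X is nonnegative. It also has the same
  form as the hypothesis on Q, so that the construction can be applied to X again. The commutation
  property is what makes square roots of related operators commute.
\<close>

lemma bounded_square_root:
  fixes Q :: "'a::{real_inner, complete_space} \<Rightarrow> 'a"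
  assumes "linear Q" "\<And>x y. Q x \<bullet> y = x \<bullet> Q y" "\<And>x. norm (x - Q x) \<le> norm x"
  obtains X where "linear X" "\<And>x y. X x \<bullet> y = x \<bullet> X y" "\<And>x. norm (x - X x) \<le> norm x"
    "\<And>x. X (X x) = Q x"
    "\<And>C x. bounded_linear C \<Longrightarrow> (\<And>x. C (Q x) = Q (C x)) \<Longrightarrow> C (X x) = X (C x)"
proof -
  interpret contraction_sqrt Q
    by (rule contraction_sqrt.intro) (fact assms)+
  define X where "X x = x - iterate_lim x" for x
  show thesis
  proof
    show "linear X"
      unfolding X_def using linear_iterate_lim linear_ident by (intro linear_compose_sub)
    show "X x \<bullet> y = x \<bullet> X y" for x y
      by (simp add: X_def inner_simps iterate_lim_symmetric)
    show "norm (x - X x) \<le> norm x" for x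
      by (simp add: X_def norm_iterate_lim)
    show "X (X x) = Q x" for x
    proof -
      have "2 *\<^sub>R iterate_lim x = x - Q x + iterate_lim (iterate_lim x)"
        by (subst iterate_lim_fixpoint) simp
      then show ?thesis
        by (simp add: X_def linear_diff[OF linear_iterate_lim] scaleR_2 algebra_simps)
    qed
    show "C (X x) = X (C x)" if "bounded_linear C" "\<And>x. C (Q x) = Q (C x)" for C x
      using iterate_lim_commutes[OF that] by (simp add: X_def linear_diff[OF bounded_linear.linear[OF that(1)]])
  qed
qed

section \<open>Square roots of unbounded selfadjoint operators\<close>

lemma adjoint_graph_eqD:
  assumes "selfadjoint_op D A" "\<And>x. x \<in> D \<Longrightarrow> A x \<bullet> y = x \<bullet> z"
  shows "y \<in> D" "A y = z"
proof -
  have "(y, z) \<in> op_graph D A"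
    using assms by (auto simp: selfadjoint_op_def adjoint_graph_def)
  then show "y \<in> D" "A y = z"
    by (auto simp: op_graph_def)
qed

lemma selfadjoint_op_symmetric:
  assumes "selfadjoint_op D A" "x \<in> D" "y \<in> D"
  shows "A x \<bullet> y = x \<bullet> A y"
proof -
  have "(y, A y) \<in> adjoint_graph D A"
    using assms by (auto simp: selfadjoint_op_def op_graph_def)
  then show ?thesis
    using assms(2) by (simp add: adjoint_graph_def)
qed

text \<open>
  Applied with a = A x this says that, for nonnegative A, the operator I + A does not decrease
  norms; the two estimates become the contractivity of the resolvent R and of I - R.
\<close>

lemma norm_shift_ge:
  fixes x a :: "'a::real_inner"
  assumes "0 \<le> a \<bullet> x"
  shows "norm x \<le> norm (x + a)" "norm a \<le> norm (x + a)"
proof -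
  have "(norm (x + a))\<^sup>2 = (norm x)\<^sup>2 + (norm a)\<^sup>2 + 2 * (a \<bullet> x)"
    unfolding power2_norm_eq_inner by (simp add: inner_simps inner_commute)
  then have "(norm x)\<^sup>2 \<le> (norm (x + a))\<^sup>2" "(norm a)\<^sup>2 \<le> (norm (x + a))\<^sup>2"
    using assms by simp_all
  then show "norm x \<le> norm (x + a)" "norm a \<le> norm (x + a)"
    by (auto intro: power2_le_imp_le)
qed

text \<open>
  If x + A x converges along a sequence in D, then so does x, by the lower bound for I + A.
  The limits satisfy the defining relation of the adjoint, so they lie on the graph of A.
\<close>

lemma closed_range_shift:
  fixes D :: "'a::{real_inner, complete_space} set"
  assumes sa: "selfadjoint_op D A" and nn: "nonneg_op D A"
  shows "closed ((\<lambda>x. x + A x) ` D)"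
  unfolding closed_sequential_limits
proof (intro allI impI)
  fix s l
  assume "(\<forall>n. s n \<in> (\<lambda>x. x + A x) ` D) \<and> s \<longlonglongrightarrow> l"
  then have "\<forall>n. \<exists>x. x \<in> D \<and> s n = x + A x" and s: "s \<longlonglongrightarrow> l"
    by auto
  then obtain x where xD: "\<And>n. x n \<in> D" and sx: "\<And>n. s n = x n + A (x n)"
    by metis
  have D: "subspace D" and add: "\<And>x y. x \<in> D \<Longrightarrow> y \<in> D \<Longrightarrow> A (x + y) = A x + A y"
    and scale: "\<And>c x. x \<in> D \<Longrightarrow> A (c *\<^sub>R x) = c *\<^sub>R A x"
    using sa by (auto simp: selfadjoint_op_def linear_op_def)
  have diff: "norm (x m - x n) \<le> norm (s m - s n)" for m n
  proof -
    have "x m - x n \<in> D"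
      using D xD by (intro subspace_diff)
    moreover have "A (x m - x n) = A (x m) - A (x n)"
      using add[OF xD subspace_neg[OF D xD], of m n] scale[OF xD, of "-1" n] by simp
    ultimately have "norm (x m - x n) \<le> norm ((x m - x n) + (A (x m) - A (x n)))"
      using nn norm_shift_ge(1)[of "A (x m - x n)" "x m - x n"] by (auto simp: nonneg_op_def)
    then show ?thesis
      by (simp add: sx algebra_simps)
  qed
  have "Cauchy s"
    using s by (rule LIMSEQ_imp_Cauchy)
  then have "Cauchy x"
    unfolding Cauchy_iff using diff by (meson le_less_trans)
  then obtain p where p: "x \<longlonglongrightarrow> p"
    using Cauchy_convergent convergent_def by blast
  have Ax: "(\<lambda>n. A (x n)) \<longlonglongrightarrow> l - p"
    using tendsto_diff[OF s p] by (simp add: sx)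
  have "A w \<bullet> p = w \<bullet> (l - p)" if w: "w \<in> D" for w
  proof -
    have "(\<lambda>n. A w \<bullet> x n) \<longlonglongrightarrow> A w \<bullet> p"
      by (intro tendsto_inner tendsto_const p)
    moreover have "(\<lambda>n. A w \<bullet> x n) \<longlonglongrightarrow> w \<bullet> (l - p)"
      unfolding selfadjoint_op_symmetric[OF sa w xD] by (intro tendsto_inner tendsto_const Ax)
    ultimately show ?thesis
      using LIMSEQ_unique by blast
  qed
  from adjoint_graph_eqD[OF sa this] have "p \<in> D" "l = p + A p"
    by auto
  then show "l \<in> (\<lambda>x. x + A x) ` D"
    by blast
qed

text \<open>
  The range is closed. A vector z orthogonal to it satisfies A x \<bullet> z = x \<bullet> (- z) for all
  x in D, so by selfadjointness A z = - z, and nonnegativity forces z = 0.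
\<close>

lemma surj_shift:
  fixes D :: "'a::{real_inner, complete_space} set"
  assumes sa: "selfadjoint_op D A" and nn: "nonneg_op D A"
  shows "(\<lambda>x. x + A x) ` D = UNIV"
proof (rule closed_subspace_eq_UNIV)
  have D: "subspace D" and add: "\<And>x y. x \<in> D \<Longrightarrow> y \<in> D \<Longrightarrow> A (x + y) = A x + A y"
    and scale: "\<And>c x. x \<in> D \<Longrightarrow> A (c *\<^sub>R x) = c *\<^sub>R A x"
    using sa by (auto simp: selfadjoint_op_def linear_op_def)
  show "subspace ((\<lambda>x. x + A x) ` D)"
  proof (rule subspaceI)
    have "0 + A 0 = 0"
      using scale[OF subspace_0[OF D], of 0] by simp
    then show "0 \<in> (\<lambda>x. x + A x) ` D"
      using subspace_0[OF D] by force
    fix u assume "u \<in> (\<lambda>x. x + A x) ` D"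
    then obtain x where x: "x \<in> D" "u = x + A x"
      by auto
    show "c *\<^sub>R u \<in> (\<lambda>x. x + A x) ` D" for c
      using x scale subspace_mul[OF D x(1), of c] by (intro image_eqI[of _ _ "c *\<^sub>R x"]) (auto simp: algebra_simps)
    fix v assume "v \<in> (\<lambda>x. x + A x) ` D"
    then obtain y where y: "y \<in> D" "v = y + A y"
      by auto
    show "u + v \<in> (\<lambda>x. x + A x) ` D"
      using x y add subspace_add[OF D x(1) y(1)] by (intro image_eqI[of _ _ "x + y"]) auto
  qed
  show "closed ((\<lambda>x. x + A x) ` D)"
    by (rule closed_range_shift[OF sa nn])
  fix z
  assume orth: "\<And>m. m \<in> (\<lambda>x. x + A x) ` D \<Longrightarrow> m \<bullet> z = 0"
  have "A x \<bullet> z = x \<bullet> (- z)" if "x \<in> D" for x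
    using orth[OF imageI[OF that]] by (simp add: inner_add_left)
  note z = adjoint_graph_eqD[OF sa this]
  then have "0 \<le> - (z \<bullet> z)"
    using nn by (auto simp: nonneg_op_def)
  then show "z = 0"
    using inner_ge_zero[of z] by (simp add: order_antisym)
qed

lemma resolvent_exists:
  fixes D :: "'a::{real_inner, complete_space} set"
  assumes sa: "selfadjoint_op D A" and nn: "nonneg_op D A"
  obtains R where "linear R" "\<And>x y. R x \<bullet> y = x \<bullet> R y"
    "\<And>x. norm (R x) \<le> norm x" "\<And>x. norm (x - R x) \<le> norm x"
    "\<And>x. R x \<in> D" "\<And>x. A (R x) = x - R x" "\<And>x. x \<in> D \<Longrightarrow> R (x + A x) = x"
proof -
  have D: "subspace D" and add: "\<And>x y. x \<in> D \<Longrightarrow> y \<in> D \<Longrightarrow> A (x + y) = A x + A y"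
    and scale: "\<And>c x. x \<in> D \<Longrightarrow> A (c *\<^sub>R x) = c *\<^sub>R A x"
    using sa by (auto simp: selfadjoint_op_def linear_op_def)
  have "\<forall>u. \<exists>x. x \<in> D \<and> x + A x = u"
    using surj_shift[OF sa nn] by (metis UNIV_I imageE)
  then obtain R where RD: "\<And>u. R u \<in> D" and R: "\<And>u. R u + A (R u) = u"
    by metis
  have AR: "A (R u) = u - R u" for u
    using R[of u] by (metis add_diff_cancel_left')
  have norms: "norm x \<le> norm (x + A x)" "norm (A x) \<le> norm (x + A x)" if "x \<in> D" for x
    using nn that by (auto simp: nonneg_op_def intro!: norm_shift_ge)
  have unique: "x = y" if "x \<in> D" "y \<in> D" "x + A x = y + A y" for x y
  proof -
    have "A (x - y) = A x - A y"
      using add[OF that(1) subspace_neg[OF D that(2)]] scale[OF that(2), of "-1"] by simp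
    then have "norm (x - y) \<le> norm ((x - y) + (A x - A y))"
      using norms(1)[OF subspace_diff[OF D that(1,2)]] by simp
    also have "(x - y) + (A x - A y) = (x + A x) - (y + A y)"
      by (simp only: algebra_simps)
    finally show ?thesis
      using that(3) by simp
  qed
  show thesis
  proof (rule that)
    show "linear R"
    proof (rule linearI)
      fix u v :: 'a and c :: real
      show "R (u + v) = R u + R v"
        by (rule unique) (auto simp: RD add subspace_add[OF D] AR)
      show "R (c *\<^sub>R u) = c *\<^sub>R R u"
        by (rule unique) (auto simp: RD scale subspace_mul[OF D] AR algebra_simps)
    qed
    show "R x \<bullet> y = x \<bullet> R y" for x y
      using selfadjoint_op_symmetric[OF sa RD[of x] RD[of y]]
      by (simp add: AR inner_diff_left inner_diff_right)
    show "norm (R x) \<le> norm x" "norm (x - R x) \<le> norm x" for x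
      using norms[OF RD[of x]] by (simp_all add: AR)
    show "R x \<in> D" "A (R x) = x - R x" for x
      by (fact RD AR)+
    show "R (x + A x) = x" if "x \<in> D" for x
      by (rule unique) (auto simp: RD AR that)
  qed
qed

lemma bounded_linear_near_id:
  fixes X :: "'a::real_inner \<Rightarrow> 'a"
  assumes "linear X" "\<And>x. norm (x - X x) \<le> norm x"
  shows "bounded_linear X"
proof -
  have "norm (X x) \<le> norm x * 2" for x
    using assms(2)[of x] norm_triangle_ineq4[of x "x - X x"] by simp
  then show ?thesis
    using assms(1) by (intro bounded_linear.intro bounded_linear_axioms.intro) (auto intro: exI[of _ 2])
qed

text \<open>
  Let R be the inverse of I + A. With the bounded square roots P of R and W of I - R one has
  A = W^2 P^(-2), which suggests W P^(-1), with domain the range of P, as the square root. The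
  operators P and W commute and satisfy P^2 + W^2 = I. This identity does most of the work: it
  writes every y as P (P y) + W (W y), so as soon as W y = P z for some z, one obtains
  y = P (P y + W z), and y lies in the range of P. Domains, the adjoint and the square are all
  computed in this way. Nonnegativity needs the product W P to be nonnegative, which is seen by
  writing P as the square of an operator S that again commutes with W.
\<close>

lemma sqrt_op_exists:
  fixes D :: "'a::{real_inner, complete_space} set"
  assumes sa: "selfadjoint_op D A" and nn: "nonneg_op D A"
  shows "\<exists>E B. is_sqrt_op D A E B"
proof -
  obtain R where R: "linear R" "\<And>x y. R x \<bullet> y = x \<bullet> R y"
    "\<And>x. norm (R x) \<le> norm x" "\<And>x. norm (x - R x) \<le> norm x"
    and RD: "\<And>x. R x \<in> D" and AR: "\<And>x. A (R x) = x - R x"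
    and RA: "\<And>x. x \<in> D \<Longrightarrow> R (x + A x) = x"
    using resolvent_exists[OF sa nn] by metis
  obtain P where P: "linear P" "\<And>x y. P x \<bullet> y = x \<bullet> P y" "\<And>x. norm (x - P x) \<le> norm x"
    and PP: "\<And>x. P (P x) = R x"
    using bounded_square_root[OF R(1,2,4)] by metis
  \<comment> \<open>The square root of P serves only to show that the product of W and P is nonnegative.\<close>
  obtain S where S: "linear S" "\<And>x y. S x \<bullet> y = x \<bullet> S y" "\<And>x. norm (x - S x) \<le> norm x"
    and SS: "\<And>x. S (S x) = P x"
    using bounded_square_root[OF P(1,2,3)] by metis
  obtain W where W: "linear W" "\<And>x y. W x \<bullet> y = x \<bullet> W y" "\<And>x. norm (x - W x) \<le> norm x"
    and WW: "\<And>x. W (W x) = x - R x"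
    and comm: "\<And>C x. bounded_linear C \<Longrightarrow> (\<And>x. C (x - R x) = C x - R (C x)) \<Longrightarrow> C (W x) = W (C x)"
  proof (rule bounded_square_root[of "\<lambda>x. x - R x"])
    show "linear (\<lambda>x. x - R x)"
      using R(1) linear_ident by (intro linear_compose_sub)
    show "(x - R x) \<bullet> y = x \<bullet> (y - R y)" for x y
      by (simp add: inner_simps R(2))
    show "norm (x - (x - R x)) \<le> norm x" for x
      by (simp add: R(3))
  qed blast
  have PW: "P (W x) = W (P x)" for x
    by (rule comm) (use P in \<open>simp_all add: bounded_linear_near_id linear_diff flip: PP\<close>)
  have SW: "S (W x) = W (S x)" for x
    by (rule comm) (use S in \<open>simp_all add: bounded_linear_near_id linear_diff flip: PP SS\<close>)
  have injP: "inj P"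
  proof -
    have "x = 0" if "P x = 0" for x
    proof -
      have Rx: "R x = 0"
        using that PP[of x] linear_0[OF P(1)] by simp
      then have "x = A 0"
        using AR[of x] by simp
      also have "A 0 = 0"
        using AR[of 0] linear_0[OF R(1)] by simp
      finally show ?thesis .
    qed
    then show ?thesis
      using linear_injective_0[OF P(1)] by blast
  qed
  define B where "B x = W (inv P x)" for x
  have BP: "B (P a) = W a" for a
    by (simp add: B_def injP)
  have D_eq: "D = range R"
    using RA RD by (metis image_subset_iff rangeI subsetI subset_antisym)
  have DE: "D \<subseteq> range P"
    unfolding D_eq by (metis PP image_subsetI rangeI)
  have "is_sqrt_op D A (range P) B"
    unfolding is_sqrt_op_def
  proof (intro conjI)
    show "selfadjoint_op (range P) B"
      unfolding selfadjoint_op_def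
    proof (intro conjI)
      show "linear_op (range P) B"
        unfolding linear_op_def
      proof (intro conjI ballI allI)
        show "subspace (range P)"
          using P(1) by (simp add: linear_subspace_image)
        show "B (x + y) = B x + B y" if "x \<in> range P" "y \<in> range P" for x y
          using that by (auto simp: BP linear_add[OF W(1)] simp flip: linear_add[OF P(1)])
        show "B (c *\<^sub>R x) = c *\<^sub>R B x" if "x \<in> range P" for c x
          using that by (auto simp: BP linear_cmul[OF W(1)] simp flip: linear_cmul[OF P(1)])
      qed
      show "closure (range P) = UNIV"
        using closure_mono[OF DE] sa by (auto simp: selfadjoint_op_def)
      show "adjoint_graph (range P) B = op_graph (range P) B"
      proof (intro equalityI subsetI)
        fix g assume "g \<in> adjoint_graph (range P) B"
        then obtain y z where g: "g = (y, z)" and "\<And>a. W a \<bullet> y = P a \<bullet> z"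
          by (auto simp: adjoint_graph_def BP)
        then have "a \<bullet> (W y - P z) = 0" for a
          by (simp add: W(2) P(2) inner_diff_right)
        then have Wy: "W y = P z"
          using inner_eq_zero_iff[of "W y - P z"] by simp
        have "y = P (P y) + W (W y)"
          by (simp add: PP WW)
        then have y: "y = P (P y + W z)"
          by (simp add: Wy PW linear_add[OF P(1)])
        have "B y = W (P y + W z)"
          by (subst y) (rule BP)
        also have "\<dots> = P (P z) + W (W z)"
          by (simp add: linear_add[OF W(1)] Wy flip: PW)
        finally have "B y = z"
          by (simp add: PP WW)
        then show "g \<in> op_graph (range P) B"
          using y by (auto simp: op_graph_def g)
      next
        fix g assume "g \<in> op_graph (range P) B"
        then obtain b where "g = (P b, W b)"
          by (auto simp: op_graph_def BP)
        then show "g \<in> adjoint_graph (range P) B"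
          by (auto simp: adjoint_graph_def BP W(2) P(2) PW)
      qed
    qed
    show "nonneg_op (range P) B"
      unfolding nonneg_op_def
    proof
      fix x assume "x \<in> range P"
      then obtain a where x: "x = P a"
        by blast
      have "W a \<bullet> P a = S (W a) \<bullet> S a"
        by (simp add: S(2) flip: SS)
      also have "\<dots> = W (S a) \<bullet> S a"
        by (simp add: SW)
      also have "0 \<le> \<dots>"
      proof -
        have "(norm (S a - W (S a)))\<^sup>2 \<le> (norm (S a))\<^sup>2"
          using W(3) by (simp add: power_mono)
        then have "W (S a) \<bullet> W (S a) \<le> 2 * (W (S a) \<bullet> S a)"
          unfolding power2_norm_eq_inner by (simp add: inner_simps inner_commute)
        then show ?thesis
          using inner_ge_zero[of "W (S a)"] by linarith
      qed
      finally show "0 \<le> B x \<bullet> x"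
        by (simp add: x BP)
    qed
    show "{x \<in> range P. B x \<in> range P} = D"
    proof (intro equalityI subsetI)
      fix x assume "x \<in> {x \<in> range P. B x \<in> range P}"
      then obtain a b where x: "x = P a" and Wa: "W a = P b"
        by (auto simp: BP)
      have "a = P (P a) + W (W a)"
        by (simp add: PP WW)
      also have "\<dots> = P (P a + W b)"
        by (simp add: Wa PW linear_add[OF P(1)])
      finally have "x = R (P a + W b)"
        using x PP by metis
      then show "x \<in> D"
        using RD by simp
    next
      fix x assume "x \<in> D"
      then obtain c where "x = P (P c)"
        using D_eq PP by auto
      then show "x \<in> {x \<in> range P. B x \<in> range P}"
        by (auto simp: BP simp flip: PW)
    qed
    show "\<forall>x\<in>D. B (B x) = A x"
    proof
      fix x assume "x \<in> D"
      then obtain c where c: "x = R c"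
        using D_eq by auto
      then have "B x = P (W c)"
        by (simp add: BP PW flip: PP)
      then show "B (B x) = A x"
        by (simp add: BP WW c AR)
    qed
  qed
  then show ?thesis
    by blast
qed

lemma sqrt_op_is_sqrt:
  fixes D :: "'a::{real_inner, complete_space} set"
  assumes "selfadjoint_op D A" "nonneg_op D A"
  shows "is_sqrt_op D A (fst (sqrt_op D A)) (snd (sqrt_op D A))"
proof -
  have "\<exists>EB. case EB of (E, B) \<Rightarrow> is_sqrt_op D A E B"
    using sqrt_op_exists[OF assms] by auto
  from someI_ex[OF this] show ?thesis
    by (simp add: sqrt_op_def case_prod_unfold)
qed

section \<open>Energy forms of the six-step BDF method\<close>

text \<open>
  This is the squared G-norm of Dahlquist's theory for the pair of polynomials 60 \<alpha>(\<zeta>) and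
  \<mu>(\<zeta>) = 36 \<zeta>^6 - 52 \<zeta>^5 + 25 \<zeta>^4 - 4 \<zeta>^3; the latter encodes
  the multiplier. The entries of G are not free once the remainder M in the dissipation identity

    (60 \<alpha>(v)) \<bullet> \<mu>(v) = G(v1,...,v6) - G(v0,...,v5) + M(v0,...,v6)

  is fixed: comparing coefficients gives G(i,j) = G(i-1,j-1) + M(i,j) - S(i,j), where S is the
  symmetric matrix of the left-hand side. Such a G exists exactly if M and S have the same sum
  along every diagonal, that is, if they have the same symbol as functions of an angle x. Here the
  symbol of S is (2 - 2 cos x) q(x) with

    q(x) = 10128 - 16606 cos x + 12236 cos 2x - 6950 cos 3x + 2392 cos 4x - 360 cos 5x > 0.

  The remainder M is obtained by writing q as the squared modulus of the polynomial with
  coefficients -46, 44, -55, 49, -22, 4, which is a rounded spectral factor of q, plus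
  150 + 4 cos x + 52 cos 2x - 66 cos 3x + 16 cos 4x + 8 cos 5x. In the second part the constant term
  dominates, so it is a nonnegative combination of 1 and of the functions 2 + 2 cos jx and
  2 - 2 cos jx, which are squared moduli. The factor 2 - 2 cos x means that everything is applied to
  the differences of consecutive entries.
\<close>

definition bdf_energy :: "'a::real_inner \<Rightarrow> 'a \<Rightarrow> 'a \<Rightarrow> 'a \<Rightarrow> 'a \<Rightarrow> 'a \<Rightarrow> real" where
  "bdf_energy v0 v1 v2 v3 v4 v5 =
     2193 * (v0 \<bullet> v0) - 8430 * (v0 \<bullet> v1) + 9156 * (v0 \<bullet> v2) - 9646 * (v0 \<bullet> v3) + 6364 * (v0 \<bullet> v4)
     - 1880 * (v0 \<bullet> v5) + 10368 * (v1 \<bullet> v1) - 26302 * (v1 \<bullet> v2) + 27706 * (v1 \<bullet> v3) - 20708 * (v1 \<bullet> v4)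
     + 7308 * (v1 \<bullet> v5) + 20197 * (v2 \<bullet> v2) - 46046 * (v2 \<bullet> v3) + 36139 * (v2 \<bullet> v4) - 14156 * (v2 \<bullet> v5)
     + 29472 * (v3 \<bullet> v3) - 49080 * (v3 \<bullet> v4) + 19307 * (v3 \<bullet> v5) + 23304 * (v4 \<bullet> v4) - 20388 * (v4 \<bullet> v5)
     + 5272 * (v5 \<bullet> v5)"

text \<open>
  The analogous quadratic form for the pair consisting of the identity and the multiplier. Here the
  symbol of twice the product is

    72 - 104 cos x + 50 cos 2x - 8 cos 3x,

  which is the sum of the squared modulus of - 4 + 5 z - 5 z^2 + z^3 at z = e^(ix), of
  2 (2 - 2 cos x), and of 1. The last summand yields the dissipation of the newest entry.
\<close>

definition multiplier_energy :: "'a::real_inner \<Rightarrow> 'a \<Rightarrow> 'a \<Rightarrow> real" where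
  "multiplier_energy w0 w1 w2 =
     18 * (w0 \<bullet> w0) - 44 * (w0 \<bullet> w1) + 40 * (w0 \<bullet> w2)
     + 45 * (w1 \<bullet> w1) - 94 * (w1 \<bullet> w2) + 70 * (w2 \<bullet> w2)"

lemma inner_diff_self_nonneg: "0 \<le> x \<bullet> x + y \<bullet> y - 2 * (x \<bullet> y)" for x y :: "'a::real_inner"
  using inner_ge_zero[of "x - y"] by (simp add: inner_simps inner_commute)

lemma inner_add_self_nonneg: "0 \<le> x \<bullet> x + y \<bullet> y + 2 * (x \<bullet> y)" for x y :: "'a::real_inner"
  using inner_ge_zero[of "x + y"] by (simp add: inner_simps inner_commute)

lemma bdf_energy_step:
  fixes v0 v1 v2 v3 v4 v5 v6 :: "'a::real_inner"
  shows "bdf_energy v1 v2 v3 v4 v5 v6 - bdf_energy v0 v1 v2 v3 v4 v5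
    \<le> (10 *\<^sub>R v0 - 72 *\<^sub>R v1 + 225 *\<^sub>R v2 - 400 *\<^sub>R v3 + 450 *\<^sub>R v4 - 360 *\<^sub>R v5 + 147 *\<^sub>R v6)
        \<bullet> (- 4 *\<^sub>R v3 + 25 *\<^sub>R v4 - 52 *\<^sub>R v5 + 36 *\<^sub>R v6)"
proof -
  define d where "d = v1 - v0"
  have "(10 *\<^sub>R v0 - 72 *\<^sub>R v1 + 225 *\<^sub>R v2 - 400 *\<^sub>R v3 + 450 *\<^sub>R v4 - 360 *\<^sub>R v5 + 147 *\<^sub>R v6)
        \<bullet> (- 4 *\<^sub>R v3 + 25 *\<^sub>R v4 - 52 *\<^sub>R v5 + 36 *\<^sub>R v6)
    = bdf_energy v1 v2 v3 v4 v5 v6 - bdf_energy v0 v1 v2 v3 v4 v5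
      + (norm (- 46 *\<^sub>R d + 44 *\<^sub>R (v2 - v1) - 55 *\<^sub>R (v3 - v2)
          + 49 *\<^sub>R (v4 - v3) - 22 *\<^sub>R (v5 - v4) + 4 *\<^sub>R (v6 - v5)))\<^sup>2
      + 2 * (norm (d + (v2 - v1)))\<^sup>2 + 26 * (norm (d + (v3 - v2)))\<^sup>2
      + 33 * (norm (d - (v4 - v3)))\<^sup>2 + 8 * (norm (d + (v5 - v4)))\<^sup>2
      + 4 * (norm (d + (v6 - v5)))\<^sup>2 + 4 * (norm d)\<^sup>2"
    unfolding bdf_energy_def power2_norm_eq_inner d_def
    by (simp add: inner_add_left inner_add_right inner_diff_left inner_diff_right inner_commute)
  then show ?thesis
    by (smt (verit) zero_le_power2)
qed

text \<open>
  The first five squares come from a Cholesky factorization of 17 times the matrix of the form,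
  less a small multiple of the identity, with rows rounded to integers; everything is then doubled
  to clear halves. The sixth row only concerns v5 and is merged with what is left over. That
  remainder is diagonally dominant: each off-diagonal entry is absorbed into the square of a sum or
  difference of two vectors, and nonnegative multiples of the squared norms remain. The last of
  them gives the constant 9, because 341 is larger than 9 times 34.
\<close>

lemma bdf_energy_ge:
  fixes v0 v1 v2 v3 v4 v5 :: "'a::real_inner"
  shows "9 * (norm v5)\<^sup>2 \<le> bdf_energy v0 v1 v2 v3 v4 v5"
proof -
  have "34 * bdf_energy v0 v1 v2 v3 v4 v5 =
      2 * (norm (192 *\<^sub>R v0 - 373 *\<^sub>R v1 + 405 *\<^sub>R v2 - 427 *\<^sub>R v3 + 282 *\<^sub>R v4 - 83 *\<^sub>R v5))\<^sup>2
      + 2 * (norm (192 *\<^sub>R v1 - 378 *\<^sub>R v2 + 397 *\<^sub>R v3 - 369 *\<^sub>R v4 + 162 *\<^sub>R v5))\<^sup>2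
      + 2 * (norm (190 *\<^sub>R v2 - 360 *\<^sub>R v3 + 282 *\<^sub>R v4 - 134 *\<^sub>R v5))\<^sup>2
      + 2 * (norm (177 *\<^sub>R v3 - 275 *\<^sub>R v4 + 91 *\<^sub>R v5))\<^sup>2
      + 2 * (norm (158 *\<^sub>R v4 - 173 *\<^sub>R v5))\<^sup>2
      + 78 * (norm (v0 - v1))\<^sup>2 + 132 * (norm (v0 + v2))\<^sup>2 + 14 * (norm (v0 - v3))\<^sup>2
      + 100 * (norm (v0 - v4))\<^sup>2 + 88 * (norm (v0 - v5))\<^sup>2 + 148 * (norm (v1 + v2))\<^sup>2
      + 12 * (norm (v1 + v3))\<^sup>2 + 32 * (norm (v1 + v4))\<^sup>2 + 110 * (norm (v1 + v5))\<^sup>2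
      + 20 * (norm (v2 + v3))\<^sup>2 + 181 * (norm (v2 - v4))\<^sup>2 + 30 * (norm (v2 - v5))\<^sup>2
      + 156 * (norm (v3 - v4))\<^sup>2 + 15 * (norm (v3 + v5))\<^sup>2 + 66 * (norm (v4 + v5))\<^sup>2
      + 422 * (norm v0)\<^sup>2 + 146 * (norm v1)\<^sup>2 + 169 * (norm v2)\<^sup>2
      + 97 * (norm v3)\<^sup>2 + 205 * (norm v4)\<^sup>2 + 341 * (norm v5)\<^sup>2"
    unfolding bdf_energy_def power2_norm_eq_inner
    by (simp add: inner_add_left inner_add_right inner_diff_left inner_diff_right inner_commute)
  then show ?thesis
    by (smt (verit) zero_le_power2)
qed

text \<open>
  By the arithmetic-geometric mean inequality for the mixed terms, any bound for the absolute row
  sums of the matrix is a bound for the form; the largest row sum is below 108000.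
\<close>

lemma bdf_energy_le:
  fixes v0 v1 v2 v3 v4 v5 :: "'a::real_inner"
  shows "bdf_energy v0 v1 v2 v3 v4 v5 \<le> 108000 *
    ((norm v0)\<^sup>2 + (norm v1)\<^sup>2 + (norm v2)\<^sup>2 + (norm v3)\<^sup>2 + (norm v4)\<^sup>2 + (norm v5)\<^sup>2)"
  unfolding bdf_energy_def power2_norm_eq_inner
  using inner_add_self_nonneg[of v0 v1] inner_diff_self_nonneg[of v0 v2] inner_add_self_nonneg[of v0 v3] inner_diff_self_nonneg[of v0 v4]
      inner_add_self_nonneg[of v0 v5] inner_add_self_nonneg[of v1 v2] inner_diff_self_nonneg[of v1 v3] inner_add_self_nonneg[of v1 v4]
      inner_diff_self_nonneg[of v1 v5] inner_add_self_nonneg[of v2 v3] inner_diff_self_nonneg[of v2 v4] inner_add_self_nonneg[of v2 v5]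
      inner_add_self_nonneg[of v3 v4] inner_diff_self_nonneg[of v3 v5] inner_add_self_nonneg[of v4 v5]
      inner_ge_zero[of v0] inner_ge_zero[of v1] inner_ge_zero[of v2] inner_ge_zero[of v3] inner_ge_zero[of v4] inner_ge_zero[of v5]
  by (smt (verit))

lemma multiplier_energy_step:
  fixes w0 w1 w2 w3 :: "'a::real_inner"
  shows "multiplier_energy w1 w2 w3 - multiplier_energy w0 w1 w2 + (norm w3)\<^sup>2
    \<le> 2 * (w3 \<bullet> (- 4 *\<^sub>R w0 + 25 *\<^sub>R w1 - 52 *\<^sub>R w2 + 36 *\<^sub>R w3))"
proof -
  have "2 * (w3 \<bullet> (- 4 *\<^sub>R w0 + 25 *\<^sub>R w1 - 52 *\<^sub>R w2 + 36 *\<^sub>R w3))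
    = multiplier_energy w1 w2 w3 - multiplier_energy w0 w1 w2 + (norm w3)\<^sup>2
      + (norm (- 4 *\<^sub>R w0 + 5 *\<^sub>R w1 - 5 *\<^sub>R w2 + w3))\<^sup>2 + 2 * (norm (w0 - w1))\<^sup>2"
    unfolding multiplier_energy_def power2_norm_eq_inner
    by (simp add: inner_add_left inner_add_right inner_diff_left inner_diff_right inner_commute)
  then show ?thesis
    by simp
qed

lemma multiplier_energy_nonneg: "0 \<le> multiplier_energy w0 w1 w2"
proof -
  have "4 * multiplier_energy w0 w1 w2
    = (norm (8 *\<^sub>R w0 - 11 *\<^sub>R w1 + 10 *\<^sub>R w2))\<^sup>2 + (norm (7 *\<^sub>R w1 - 11 *\<^sub>R w2))\<^sup>2
      + (norm (w1 - w2))\<^sup>2 + 8 * (norm w0)\<^sup>2 + 9 * (norm w1)\<^sup>2 + 58 * (norm w2)\<^sup>2"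
    unfolding multiplier_energy_def power2_norm_eq_inner
    by (simp add: inner_add_left inner_add_right inner_diff_left inner_diff_right inner_commute)
  then show ?thesis
    by (smt (verit) zero_le_power2)
qed

lemma multiplier_energy_le:
  "multiplier_energy w0 w1 w2 \<le> 137 * ((norm w0)\<^sup>2 + (norm w1)\<^sup>2 + (norm w2)\<^sup>2)"
  unfolding multiplier_energy_def power2_norm_eq_inner
  using inner_add_self_nonneg[of w0 w1] inner_diff_self_nonneg[of w0 w2] inner_add_self_nonneg[of w1 w2]
      inner_ge_zero[of w0] inner_ge_zero[of w1] inner_ge_zero[of w2]
  by (smt (verit))

section \<open>Stability\<close>

lemma bdf6_poly_eq: "bdf6_poly = [:1/6, - 6/5, 15/4, - 20/3, 15/2, - 6, 49/20:]"
  by (simp add: bdf6_poly_def numeral_eq_Suc monom_Suc monom_0)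

lemma bdf6_sum:
  fixes u :: "nat \<Rightarrow> 'a::real_vector"
  shows "60 *\<^sub>R (\<Sum>i=0..6. bdf6_coeff i *\<^sub>R u (n + i)) =
    10 *\<^sub>R u n - 72 *\<^sub>R u (n + 1) + 225 *\<^sub>R u (n + 2) - 400 *\<^sub>R u (n + 3)
      + 450 *\<^sub>R u (n + 4) - 360 *\<^sub>R u (n + 5) + 147 *\<^sub>R u (n + 6)"
proof -
  have range: "{0..6::nat} = {0, 1, 2, 3, 4, 5, 6}"
    by auto
  have coeffs: "bdf6_coeff 0 = 1/6" "bdf6_coeff 1 = - 6/5" "bdf6_coeff 2 = 15/4" "bdf6_coeff 3 = - 20/3"
    "bdf6_coeff 4 = 15/2" "bdf6_coeff 5 = - 6" "bdf6_coeff 6 = 49/20"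
    by (simp_all add: bdf6_coeff_def bdf6_poly_eq numeral_eq_Suc)
  show ?thesis
    by (simp add: range coeffs coeffs(2)[unfolded One_nat_def] algebra_simps)
qed

text \<open>
  One step of the scheme, multiplied by 60, is tested with 36 times the multiplier. The vector a
  stands for A v6, and each w for the image of the corresponding v under the square root of A, so
  that the hypotheses on inner products express that A is the square of a symmetric operator.
\<close>

lemma bdf_scheme_dissipation:
  fixes v0 v1 v2 v3 v4 v5 v6 a :: "'a::real_inner" and w3 w4 w5 w6 :: "'b::real_inner"
  assumes scheme: "10 *\<^sub>R v0 - 72 *\<^sub>R v1 + 225 *\<^sub>R v2 - 400 *\<^sub>R v3 + 450 *\<^sub>R v4 - 360 *\<^sub>R v5
      + 147 *\<^sub>R v6 + (60 * \<tau>) *\<^sub>R a = 0"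
    and form: "a \<bullet> v3 = w6 \<bullet> w3" "a \<bullet> v4 = w6 \<bullet> w4" "a \<bullet> v5 = w6 \<bullet> w5" "a \<bullet> v6 = w6 \<bullet> w6"
    and \<tau>: "0 \<le> \<tau>"
  shows "bdf_energy v1 v2 v3 v4 v5 v6 + 30 * \<tau> * multiplier_energy w4 w5 w6 + 30 * \<tau> * (norm w6)\<^sup>2
    \<le> bdf_energy v0 v1 v2 v3 v4 v5 + 30 * \<tau> * multiplier_energy w3 w4 w5"
proof -
  define m where "m = - 4 *\<^sub>R v3 + 25 *\<^sub>R v4 - 52 *\<^sub>R v5 + 36 *\<^sub>R v6"
  define r where "r = - 4 *\<^sub>R w3 + 25 *\<^sub>R w4 - 52 *\<^sub>R w5 + 36 *\<^sub>R w6"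
  have "a \<bullet> m = w6 \<bullet> r"
    by (simp add: m_def r_def inner_add_right inner_diff_right form)
  moreover have "(10 *\<^sub>R v0 - 72 *\<^sub>R v1 + 225 *\<^sub>R v2 - 400 *\<^sub>R v3 + 450 *\<^sub>R v4 - 360 *\<^sub>R v5
      + 147 *\<^sub>R v6) \<bullet> m + 60 * \<tau> * (a \<bullet> m) = 0"
    using arg_cong[OF scheme, of "\<lambda>x. x \<bullet> m"] by (simp only: inner_add_left inner_scaleR_left inner_zero_left)
  ultimately have "bdf_energy v1 v2 v3 v4 v5 v6 - bdf_energy v0 v1 v2 v3 v4 v5 + 30 * \<tau> * (2 * (w6 \<bullet> r)) \<le> 0"
    using bdf_energy_step[of v1 v2 v3 v4 v5 v6 v0] by (simp add: m_def)
  moreover have "30 * \<tau> * (multiplier_energy w4 w5 w6 - multiplier_energy w3 w4 w5 + (norm w6)\<^sup>2)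
      \<le> 30 * \<tau> * (2 * (w6 \<bullet> r))"
    using multiplier_energy_step[of w4 w5 w6 w3] \<tau> unfolding r_def by (intro mult_left_mono) auto
  ultimately show ?thesis
    by (simp add: algebra_simps)
qed

text \<open>
  The dissipation inequality telescopes. The energy F at level k involves u k, ..., u (k + 5), so at
  k = n - 5 it controls u n from below, and at k = 0 it is bounded by the starting data. The constant
  is 12000 = 108000 / 9, and nothing here depends on A, T, N or n.
\<close>

lemma bdf6_stability:
  fixes D :: "'a::real_inner set"
  assumes sqrt: "is_sqrt_op D A E B"
    and init: "\<And>j. j \<le> 5 \<Longrightarrow> u j \<in> E"
    and scheme: "bdf6_scheme D A \<tau> N u"
    and \<tau>: "0 \<le> \<tau>" and n: "6 \<le> n" "n \<le> N"
  shows "(norm (u n))\<^sup>2 + \<tau> * (\<Sum>l=6..n. (norm (B (u l)))\<^sup>2)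
    \<le> 12000 * (\<Sum>j=0..5. (norm (u j))\<^sup>2 + \<tau> * (norm (B (u j)))\<^sup>2)"
proof -
  define F where "F k = bdf_energy (u k) (u (k + 1)) (u (k + 2)) (u (k + 3)) (u (k + 4)) (u (k + 5))
    + 30 * \<tau> * multiplier_energy (B (u (k + 3))) (B (u (k + 4))) (B (u (k + 5)))" for k
  have sa: "selfadjoint_op E B" and DE: "D = {x \<in> E. B x \<in> E}" and BB: "\<And>x. x \<in> D \<Longrightarrow> B (B x) = A x"
    using sqrt by (auto simp: is_sqrt_op_def)
  have form: "A x \<bullet> y = B x \<bullet> B y" if "x \<in> D" "y \<in> E" for x y
    using selfadjoint_op_symmetric[OF sa, of "B x" y] that DE BB by auto
  have uD: "u k \<in> D" if "6 \<le> k" "k \<le> N" for k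
    using scheme that le_add_diff_inverse2[OF that(1)] unfolding bdf6_scheme_def by metis
  have uE: "u k \<in> E" if "k \<le> N" for k
    using init[of k] uD[of k] that DE by (cases "k \<le> 5") auto
  have step: "F (Suc k) + 30 * \<tau> * (norm (B (u (k + 6))))\<^sup>2 \<le> F k" if k: "k + 6 \<le> N" for k
  proof -
    have "(\<Sum>i=0..6. bdf6_coeff i *\<^sub>R u (k + i)) + \<tau> *\<^sub>R A (u (k + 6)) = 0"
      using scheme k by (simp add: bdf6_scheme_def)
    then have eq: "10 *\<^sub>R u k - 72 *\<^sub>R u (k + 1) + 225 *\<^sub>R u (k + 2) - 400 *\<^sub>R u (k + 3)
      + 450 *\<^sub>R u (k + 4) - 360 *\<^sub>R u (k + 5) + 147 *\<^sub>R u (k + 6) + (60 * \<tau>) *\<^sub>R A (u (k + 6)) = 0"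
      unfolding bdf6_sum[symmetric] by (metis scaleR_right_distrib scaleR_scaleR scaleR_zero_right)
    have "u (k + 6) \<in> D"
      using uD k by simp
    \<comment> \<open>The products of A (u (k + 6)) with starting values, which lie in E but perhaps not in D,
    are covered too, since one factor B is moved to the other side.\<close>
    note form = form[OF this]
    have "k + 3 \<le> N" "k + 4 \<le> N" "k + 5 \<le> N" "k + 6 \<le> N"
      using k by auto
    note form = this[THEN uE, THEN form]
    show ?thesis
      using bdf_scheme_dissipation[OF eq form \<tau>] by (simp add: F_def numeral_eq_Suc)
  qed
  have decay: "F k + 30 * \<tau> * (\<Sum>l=6..<k+6. (norm (B (u l)))\<^sup>2) \<le> F 0" if "k + 5 \<le> N" for k
    using that
  proof (induction k)
    case (Suc k)
    have "{6..<Suc k + 6} = insert (k + 6) {6..<k + 6}"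
      by auto
    then show ?case
      using step[of k] Suc by (simp add: algebra_simps)
  qed simp
  define k where "k = n - 5"
  have k: "k + 5 = n"
    using n by (simp add: k_def)
  have "9 * (norm (u n))\<^sup>2 + 30 * \<tau> * 0
      \<le> bdf_energy (u k) (u (k + 1)) (u (k + 2)) (u (k + 3)) (u (k + 4)) (u (k + 5))
        + 30 * \<tau> * multiplier_energy (B (u (k + 3))) (B (u (k + 4))) (B (u (k + 5)))"
    unfolding k[symmetric] using \<tau>
    by (intro add_mono mult_left_mono bdf_energy_ge multiplier_energy_nonneg) auto
  then have "9 * (norm (u n))\<^sup>2 \<le> F k"
    by (simp add: F_def)
  moreover have "{6..<k+6} = {6..n}"
    using k by auto
  moreover have "0 \<le> \<tau> * (\<Sum>l=6..n. (norm (B (u l)))\<^sup>2)"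
    using \<tau> by (simp add: sum_nonneg)
  ultimately have "9 * ((norm (u n))\<^sup>2 + \<tau> * (\<Sum>l=6..n. (norm (B (u l)))\<^sup>2)) \<le> F 0"
    using decay[of k] k n(2) by simp
  also have "F 0 \<le> 108000 * ((norm (u 0))\<^sup>2 + (norm (u 1))\<^sup>2 + (norm (u 2))\<^sup>2 + (norm (u 3))\<^sup>2
        + (norm (u 4))\<^sup>2 + (norm (u 5))\<^sup>2)
      + 30 * \<tau> * (137 * ((norm (B (u 3)))\<^sup>2 + (norm (B (u 4)))\<^sup>2 + (norm (B (u 5)))\<^sup>2))"
    unfolding F_def add_0 using \<tau>
    by (intro add_mono mult_left_mono bdf_energy_le multiplier_energy_le) auto
  also have "\<dots> = 108000 * (\<Sum>j=0..5. (norm (u j))\<^sup>2) + 4110 * (\<tau> * (\<Sum>j=3..5. (norm (B (u j)))\<^sup>2))"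
    by (simp add: numeral_eq_Suc algebra_simps)
  also have "\<dots> \<le> 108000 * (\<Sum>j=0..5. (norm (u j))\<^sup>2) + 108000 * (\<tau> * (\<Sum>j=0..5. (norm (B (u j)))\<^sup>2))"
    using \<tau> by (intro add_mono order_refl mult_mono sum_mono2) (auto intro!: mult_nonneg_nonneg sum_nonneg)
  also have "\<dots> = 108000 * (\<Sum>j=0..5. (norm (u j))\<^sup>2 + \<tau> * (norm (B (u j)))\<^sup>2)"
    by (simp only: sum.distrib sum_distrib_left distrib_left)
  finally show ?thesis
    by simp
qed

theorem theorem3p1:
  fixes T :: real and D :: "'a::{real_inner, complete_space} set" and A :: "'a \<Rightarrow> 'a"
  assumes "0 < T" and "selfadjoint_op D A" and "positive_definite_op D A"
  shows "\<exists>C::real. \<forall>N::nat. N \<ge> 6 \<longrightarrow> (let \<tau> = T / real N in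
    \<forall>u :: nat \<Rightarrow> 'a. (\<forall>j\<in>{0..5}. u j \<in> V_space D A) \<and> bdf6_scheme D A \<tau> N u \<longrightarrow>
      (\<forall>n\<in>{6..N}. (norm (u n))\<^sup>2 + \<tau> * (\<Sum>l=6..n. (V_norm D A (u l))\<^sup>2)
        \<le> C * (\<Sum>j=0..5. (norm (u j))\<^sup>2 + \<tau> * (V_norm D A (u j))\<^sup>2)))"
proof (intro exI[of _ 12000] allI impI)
  have "nonneg_op D A"
    unfolding nonneg_op_def
  proof
    fix x assume "x \<in> D"
    then show "0 \<le> A x \<bullet> x"
      using assms(3) by (cases "x = 0") (auto simp: positive_definite_op_def less_imp_le)
  qed
  note sqrt = sqrt_op_is_sqrt[OF assms(2) this]
  fix N :: nat
  assume "6 \<le> N"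
  then show "let \<tau> = T / real N in
    \<forall>u :: nat \<Rightarrow> 'a. (\<forall>j\<in>{0..5}. u j \<in> V_space D A) \<and> bdf6_scheme D A \<tau> N u \<longrightarrow>
      (\<forall>n\<in>{6..N}. (norm (u n))\<^sup>2 + \<tau> * (\<Sum>l=6..n. (V_norm D A (u l))\<^sup>2)
        \<le> 12000 * (\<Sum>j=0..5. (norm (u j))\<^sup>2 + \<tau> * (V_norm D A (u j))\<^sup>2))"
    unfolding Let_def V_space_def V_norm_def
    using \<open>0 < T\<close> by (intro allI impI ballI bdf6_stability[OF sqrt]) auto
qed

end
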